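(* Let $d$ be an odd prime, let $\rho$ be a density operator on $\mathbb{C}^d\otimes\mathbb{C}^d$, and let $k,k'\in\{0,\dots,d-1\}$ with $k\neq k'$. Let $|\Phi\rangle=\frac{1}{\sqrt d}\sum_{m=0}^{d-1}|m\rangle\otimes|m\rangle$ and $F(\rho,\Phi)=\langle\Phi|\rho|\Phi\rangle$. For $\ell\in\{k,k'\}$ and $m,n\in\{0,\dots,d-1\}$ put $$P^{(\ell)}_{mn}:=\langle \tilde m_\ell\,\tilde n_\ell^{*}|\,\rho\,|\tilde m_\ell\,\tilde n_\ell^{*}\rangle ,$$ where $|\tilde j_\ell\rangle$ are the Wootters–Fields basis vectors. Then $$F(\rho,\Phi)\;\ge\;\frac1d\sum_{m=0}^{d-1}P^{(k)}_{mm}\;+\;\sum_{m=0}^{d-1}P^{(k')}_{mm}\;-\;\frac1d\;-\;\sum_{\substack{m,n,m',n'\in\{0,\dots,d-1\}\\ m\neq m',\; m\neq n,\; n\neq n',\; n'\neq m'}}\tilde\gamma_{mnm'n'}\,\sqrt{P^{(k)}_{m'n'}\,P^{(k)}_{mn}}\,,$$ where $\tilde\gamma_{mnm'n'}=0$ if $m-m'-n+n'\not\equiv 0 \pmod d$, and $\tilde\gamma_{mnm'n'}=\frac1d$ otherwise.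
   Context: $\{|m\rangle\}_{m=0}^{d-1}$ is the standard orthonormal basis of $\mathbb{C}^d$. With $\omega=\exp(2\pi i/d)$, the $k$-th Wootters–Fields basis ($k\in\{0,\dots,d-1\}$) of $\mathbb{C}^d$ consists of the vectors $$|\tilde j_k\rangle=\frac{1}{\sqrt d}\sum_{m=0}^{d-1}\omega^{jm+km^2}|m\rangle,\qquad j\in\{0,\dots,d-1\}.$$ $|\tilde j_k^{*}\rangle=\frac{1}{\sqrt d}\sum_{m}\omega^{-jm-km^2}|m\rangle$ denotes the entrywise complex conjugate of $|\tilde j_k\rangle$ with respect to the standard basis, and $|\tilde m_k\tilde n_k^{*}\rangle:=|\tilde m_k\rangle\otimes|\tilde n_k^{*}\rangle$. A density operator is a positive semidefinite operator of trace one. *)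

theory Defs
  imports
    Complex_Main
    "HOL-Number_Theory.Cong"
    "HOL-Computational_Algebra.Primes"
    "Jordan_Normal_Form.Matrix"
    "Jordan_Normal_Form.Schur_Decomposition"
begin

text \<open>
  Kronecker product of vectors: \<open>\<complex>\<^sup>a \<otimes> \<complex>\<^sup>b\<close> is realised as \<open>\<complex>\<^sup>a\<^sup>b\<close>, with the basis
  vector \<open>|p\<rangle> \<otimes> |q\<rangle>\<close> at index \<open>p * b + q\<close>.
\<close>

definition tensor_vec :: "complex vec \<Rightarrow> complex vec \<Rightarrow> complex vec" where
  "tensor_vec u v =
     vec (dim_vec u * dim_vec v) (\<lambda>i. u $ (i div dim_vec v) * v $ (i mod dim_vec v))"

definition trace_mat :: "complex mat \<Rightarrow> complex" where
  "trace_mat A = (\<Sum>i<dim_row A. A $$ (i, i))"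

text \<open>
  \<open>x \<bullet>c y\<close> conjugates its second argument, so \<open>(A *\<^sub>v v) \<bullet>c v\<close> is \<open>\<langle>v|A|v\<rangle>\<close>. In the order on
  the complex numbers used here, \<open>0 \<le> z\<close> says that \<open>z\<close> is real and nonnegative.
\<close>

definition pos_semidef :: "nat \<Rightarrow> complex mat \<Rightarrow> bool" where
  "pos_semidef n A \<longleftrightarrow> A \<in> carrier_mat n n \<and> mat_adjoint A = A \<and>
     (\<forall>v \<in> carrier_vec n. 0 \<le> (A *\<^sub>v v) \<bullet>c v)"

definition density_operator :: "nat \<Rightarrow> complex mat \<Rightarrow> bool" where
  "density_operator n A \<longleftrightarrow> pos_semidef n A \<and> trace_mat A = 1"

text \<open>
  The real part only serves to land in the reals: \<open>\<langle>v|A|v\<rangle>\<close> is real whenever \<open>A\<close> is Hermitian.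
\<close>

definition expectation_value :: "complex mat \<Rightarrow> complex vec \<Rightarrow> real" where
  "expectation_value A v = Re ((A *\<^sub>v v) \<bullet>c v)"

definition omega :: "nat \<Rightarrow> complex" where
  "omega d = exp (2 * of_real pi * \<i> / of_nat d)"

definition wootters_fields :: "nat \<Rightarrow> nat \<Rightarrow> nat \<Rightarrow> complex vec" where
  "wootters_fields d k j =
     vec d (\<lambda>m. of_real (1 / sqrt (real d)) * omega d ^ (j * m + k * m\<^sup>2))"

definition max_entangled :: "nat \<Rightarrow> complex vec" where
  "max_entangled d = of_real (1 / sqrt (real d)) \<cdot>\<^sub>v
     finsum_vec TYPE(complex) (d * d)
       (\<lambda>m. tensor_vec (unit_vec d m) (unit_vec d m)) {..<d}"

definition wf_prob :: "nat \<Rightarrow> complex mat \<Rightarrow> nat \<Rightarrow> nat \<Rightarrow> nat \<Rightarrow> real" where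
  "wf_prob d \<rho> l m n =
     expectation_value \<rho>
       (tensor_vec (wootters_fields d l m) (conjugate (wootters_fields d l n)))"

definition gamma_tilde :: "nat \<Rightarrow> nat \<Rightarrow> nat \<Rightarrow> nat \<Rightarrow> nat \<Rightarrow> real" where
  "gamma_tilde d m n m' n' =
     (if [int m - int m' - int n + int n' = 0] (mod int d) then 1 / real d else 0)"

end

theory Submission
  imports Defs
begin

text \<open>
  Let \<open>\<chi>\<^sub>\<delta>\<close> be the vector with entry \<open>\<omega>^(k'(s\<^sup>2 - t\<^sup>2)) / \<surd>d\<close> at \<open>|s t\<rangle>\<close> when \<open>s \<equiv> t + \<delta>\<close>, and \<open>0\<close>
  elsewhere; then \<open>\<chi>\<^sub>0 = \<Phi>\<close>. The vectors \<open>|m\<^sub>k\<^sub>' m\<^sub>k\<^sub>'*\<rangle>\<close> and the vectors \<open>\<chi>\<^sub>\<delta>\<close> resolve the same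
  projection, so the fidelity is \<open>\<Sum>\<^sub>m P\<^sup>(\<^sup>k\<^sup>'\<^sup>)\<^sub>m\<^sub>m\<close> minus the expectations of the \<open>\<chi>\<^sub>\<delta>\<close> with \<open>\<delta> \<noteq> 0\<close>.
  The coefficient of \<open>\<chi>\<^sub>\<delta>\<close> at \<open>|j\<^sub>k l\<^sub>k*\<rangle>\<close> is a linear character sum: because \<open>s\<^sup>2 - t\<^sup>2\<close> is affine
  in \<open>t\<close> on the line \<open>s = t + \<delta>\<close>, no Gauss sum appears. It has modulus \<open>1/\<surd>d\<close> if
  \<open>j - l \<equiv> 2(k' - k)\<delta>\<close> and vanishes otherwise. The triangle inequality for the seminorm
  \<open>\<surd>\<langle>v|\<rho>|v\<rangle>\<close> then bounds each expectation by \<open>(\<Sum> \<surd>P\<^sub>j\<^sub>l)\<^sup>2 / d\<close> over these pairs; \<open>2(k' - k)\<close> is a unit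
  modulo \<open>d\<close>, so different \<open>\<delta>\<close> use disjoint sets of pairs, all with \<open>j \<noteq> l\<close>. The diagonal of the
  squared sums gives \<open>(1 - \<Sum>\<^sub>m P\<^sup>(\<^sup>k\<^sup>)\<^sub>m\<^sub>m)/d\<close> since \<open>\<rho>\<close> has trace one.
\<close>

section \<open>Quadratic forms on functions, and the triangle inequality for their square
  roots\<close>

definition quad_form :: "'i set \<Rightarrow> ('i \<Rightarrow> 'i \<Rightarrow> complex) \<Rightarrow> ('i \<Rightarrow> complex) \<Rightarrow> real" where
  "quad_form X A f = Re (\<Sum>x\<in>X. \<Sum>y\<in>X. A x y * f y * cnj (f x))"

lemma quad_form_cong:
  "(\<And>x. x \<in> X \<Longrightarrow> f x = g x) \<Longrightarrow> quad_form X A f = quad_form X A g"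
  unfolding quad_form_def by (intro arg_cong[where f = Re] sum.cong refl) auto

lemma quad_form_scale: "quad_form X A (\<lambda>x. c * f x) = (cmod c)\<^sup>2 * quad_form X A f"
proof -
  have "(\<Sum>x\<in>X. \<Sum>y\<in>X. A x y * (c * f y) * cnj (c * f x)) =
        (c * cnj c) * (\<Sum>x\<in>X. \<Sum>y\<in>X. A x y * f y * cnj (f x))"
    by (simp add: sum_distrib_left mult_ac)
  then show ?thesis
    unfolding quad_form_def by (simp add: complex_norm_square[symmetric] del: complex_cnj_mult)
qed

text \<open>The family enters only through the kernel of \<open>\<Sum>a |f a><f a|\<close>. Two
  families with the same kernel thus have equal total expectation, and a kernel equal to the
  identity gives the real part of the trace.\<close>

lemma sum_quad_form:
  "(\<Sum>a\<in>K. quad_form X A (f a)) =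
     Re (\<Sum>x\<in>X. \<Sum>y\<in>X. A x y * (\<Sum>a\<in>K. f a y * cnj (f a x)))"
proof -
  have "(\<Sum>a\<in>K. \<Sum>x\<in>X. \<Sum>y\<in>X. A x y * f a y * cnj (f a x)) =
        (\<Sum>x\<in>X. \<Sum>y\<in>X. A x y * (\<Sum>a\<in>K. f a y * cnj (f a x)))"
    by (simp add: sum_distrib_left mult.assoc sum.swap[of _ _ K])
  then show ?thesis
    unfolding quad_form_def Re_sum[symmetric] by simp
qed

text \<open>Along \<open>f + t g\<close> the form is a nonnegative quadratic in real
  \<open>t\<close>. Its discriminant bounds the cross term \<open>r\<close> by
  \<open>2 sqrt a sqrt b\<close>, and \<open>t = 1\<close> gives the triangle inequality.\<close>

lemma sqrt_quad_form_add:
  assumes psd: "\<And>f. 0 \<le> quad_form X A f"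
  shows "sqrt (quad_form X A (\<lambda>x. f x + g x)) \<le> sqrt (quad_form X A f) + sqrt (quad_form X A g)"
proof -
  define a b where "a = quad_form X A f" and "b = quad_form X A g"
  define r where "r = Re (\<Sum>x\<in>X. \<Sum>y\<in>X. A x y * (f y * cnj (g x) + g y * cnj (f x)))"
  have exp: "quad_form X A (\<lambda>x. f x + of_real t * g x) = a + t * r + t\<^sup>2 * b" for t
  proof -
    have "(\<Sum>x\<in>X. \<Sum>y\<in>X. A x y * (f y + of_real t * g y) * cnj (f x + of_real t * g x)) =
        (\<Sum>x\<in>X. \<Sum>y\<in>X. A x y * f y * cnj (f x))
        + of_real t * (\<Sum>x\<in>X. \<Sum>y\<in>X. A x y * (f y * cnj (g x) + g y * cnj (f x)))
        + of_real (t\<^sup>2) * (\<Sum>x\<in>X. \<Sum>y\<in>X. A x y * g y * cnj (g x))"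
      unfolding sum_distrib_left sum.distrib[symmetric]
      by (intro sum.cong refl) (simp add: algebra_simps power2_eq_square)
    then show ?thesis
      unfolding quad_form_def a_def b_def r_def by simp
  qed
  have a0: "0 \<le> a" and b0: "0 \<le> b" using psd by (auto simp: a_def b_def)
  have nonneg: "0 \<le> a + t * r + t\<^sup>2 * b" for t
    using psd[of "\<lambda>x. f x + of_real t * g x"] exp[of t] by simp
  have disc: "r\<^sup>2 \<le> 4 * a * b"
  proof (cases "b = 0")
    case True
    have "r = 0"
    proof (rule ccontr)
      assume "r \<noteq> 0"
      \<comment> \<open>With \<open>b = 0\<close> the quadratic is linear in \<open>t\<close>, and
        this \<open>t\<close> gives it the value -1.\<close>
      then show False using nonneg[of "- (a + 1) / r"] True by simp
    qed
    then show ?thesis using True by simp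
  next
    case False
    then have "0 < b" using b0 by simp
    then show ?thesis
      \<comment> \<open>The minimiser of the quadratic.\<close>
      using nonneg[of "- r / (2 * b)"]
      by (simp add: field_simps power2_eq_square)
  qed
  have "r \<le> sqrt (4 * a * b)" using disc by (rule real_le_rsqrt)
  then have "r \<le> 2 * (sqrt a * sqrt b)" by (simp add: real_sqrt_mult)
  then have "a + r + b \<le> (sqrt a + sqrt b)\<^sup>2"
    using a0 b0 by (simp add: power2_sum)
  moreover have "quad_form X A (\<lambda>x. f x + g x) = a + r + b" using exp[of 1] by simp
  ultimately show ?thesis
    using a0 b0 unfolding a_def[symmetric] b_def[symmetric] by (simp add: real_le_lsqrt)
qed

text \<open>Only the moduli of the coefficients survive, so the character sums below need be known
  only up to phase.\<close>

lemma sqrt_quad_form_sum: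
  assumes psd: "\<And>f. 0 \<le> quad_form X A f" and "finite K"
  shows "sqrt (quad_form X A (\<lambda>x. \<Sum>a\<in>K. c a * f a x)) \<le>
    (\<Sum>a\<in>K. cmod (c a) * sqrt (quad_form X A (f a)))"
  using \<open>finite K\<close>
proof (induction K rule: finite_induct)
  case empty
  then show ?case by (simp add: quad_form_def)
next
  case (insert b K)
  have "sqrt (quad_form X A (\<lambda>x. c b * f b x + (\<Sum>a\<in>K. c a * f a x))) \<le>
    sqrt (quad_form X A (\<lambda>x. c b * f b x)) + sqrt (quad_form X A (\<lambda>x. \<Sum>a\<in>K. c a * f a x))"
    by (rule sqrt_quad_form_add[OF psd])
  also have "sqrt (quad_form X A (\<lambda>x. c b * f b x)) = cmod (c b) * sqrt (quad_form X A (f b))"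
    by (simp add: quad_form_scale real_sqrt_mult)
  finally show ?case using insert by simp
qed

text \<open>Exchanging the sums exposes the completeness relation of \<open>b\<close>, which
  collapses the sum over \<open>y\<close> to \<open>y = x\<close>.\<close>

lemma resolution_expand:
  assumes "finite X" "x \<in> X"
    and res: "\<And>y. y \<in> X \<Longrightarrow> (\<Sum>a\<in>K. b a x * cnj (b a y)) = (if x = y then 1 else 0)"
  shows "(\<Sum>a\<in>K. (\<Sum>y\<in>X. f y * cnj (b a y)) * b a x) = f x"
proof -
  have "(\<Sum>a\<in>K. (\<Sum>y\<in>X. f y * cnj (b a y)) * b a x) =
        (\<Sum>y\<in>X. f y * (\<Sum>a\<in>K. b a x * cnj (b a y)))"
    by (simp add: sum_distrib_left sum_distrib_right mult_ac sum.swap[of _ _ K])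
  also have "\<dots> = (\<Sum>y\<in>X. f y * (if x = y then 1 else 0))"
    using res by (intro sum.cong) auto
  also have "\<dots> = f x"
    using assms(1,2) by (simp add: if_distrib[of "\<lambda>z. _ * z"] cong: if_cong)
  finally show ?thesis .
qed

section \<open>Additive characters modulo \<open>d\<close>\<close>

definition add_char :: "nat \<Rightarrow> int \<Rightarrow> complex" where
  "add_char d z = cis (2 * pi * real_of_int z / real d)"

lemma add_char_add: "add_char d (x + y) = add_char d x * add_char d y"
  by (simp add: add_char_def cis_mult add_divide_distrib ring_distribs)

lemma add_char_0 [simp]: "add_char d 0 = 1"
  by (simp add: add_char_def)

lemma cmod_add_char [simp]: "cmod (add_char d x) = 1"
  by (simp add: add_char_def)

text \<open>Integer arguments make conjugation a negation, so products of Wootters-Fields entries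
  and their conjugates collapse to a single character.\<close>

lemma cnj_add_char: "cnj (add_char d x) = add_char d (- x)"
  by (simp add: add_char_def cis_cnj)

lemma add_char_mult_nat: "add_char d (int n * x) = add_char d x ^ n"
  by (simp add: add_char_def DeMoivre algebra_simps)

lemma omega_power: "omega d ^ n = add_char d (int n)"
proof -
  have "omega d = add_char d 1"
    by (simp add: omega_def add_char_def cis_conv_exp mult_ac)
  then show ?thesis using add_char_mult_nat[of d n 1] by simp
qed

lemma add_char_eq_1_iff:
  assumes "0 < d"
  shows "add_char d z = 1 \<longleftrightarrow> int d dvd z"
proof
  assume "add_char d z = 1"
  then have "cos (2 * pi * real_of_int z / real d) = 1"
    by (simp add: add_char_def complex_eq_iff)
  then obtain n :: int where "2 * pi * real_of_int z / real d = of_int n * 2 * pi"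
    using cos_one_2pi_int by blast
  then have "real_of_int z = real_of_int (n * int d)"
    using assms by (simp add: field_simps)
  then show "int d dvd z" unfolding of_int_eq_iff by simp
next
  assume "int d dvd z"
  then obtain n where n: "z = int d * n" by blast
  have "2 * pi * real_of_int z / real d = 2 * pi * of_int n" using assms n by simp
  then show "add_char d z = 1" unfolding add_char_def by (simp del: of_int_mult)
qed

lemma add_char_cong:
  assumes "0 < d" "int d dvd x - y"
  shows "add_char d x = add_char d y"
  using add_char_add[of d "x - y" y] add_char_eq_1_iff[of d "x - y"] assms by simp

text \<open>Off the multiples of \<open>d\<close> this is a geometric sum whose ratio is a
  \<open>d\<close>-th root of unity other than 1.\<close>

lemma sum_add_char:
  assumes "0 < d"
  shows "(\<Sum>t<d. add_char d (int t * a)) = (if int d dvd a then of_nat d else 0)"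
proof (cases "int d dvd a")
  case True
  then have "add_char d (int t * a) = 1" for t
    using add_char_eq_1_iff[OF assms, of "int t * a"] by simp
  then show ?thesis using True by simp
next
  case False
  then have "add_char d a \<noteq> 1" using add_char_eq_1_iff[OF assms] by simp
  moreover have "add_char d a ^ d = 1"
    using add_char_eq_1_iff[OF assms, of "int d * a"] by (simp add: add_char_mult_nat)
  ultimately show ?thesis
    using False by (simp add: add_char_mult_nat geometric_sum)
qed

lemma int_dvd_diff_less_iff:
  assumes "m < d" "n < (d::nat)"
  shows "int d dvd int m - int n \<longleftrightarrow> m = n"
proof
  assume "int d dvd int m - int n"
  then have "int m mod int d = int n mod int d"
    using mod_eq_dvd_iff by blast
  then show "m = n" using assms by simp
qed simp

text \<open>Applied to \<open>s\<close> on the line \<open>s = t + \<delta>\<close>, and to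
  \<open>\<delta>\<close> at fixed \<open>s - t\<close>.\<close>

lemma sum_unique_residue:
  assumes "0 < d"
  shows "(\<Sum>s<d. if int d dvd int s - a then c else (0::complex)) = c"
proof -
  define r where "r = nat (a mod int d)"
  have r: "r < d" "int r = a mod int d"
    using assms by (auto simp: r_def nat_less_iff)
  have "int d dvd int s - a \<longleftrightarrow> s = r" if "s < d" for s
  proof -
    have "int d dvd int s - a \<longleftrightarrow> int s mod int d = a mod int d"
      by (rule mod_eq_dvd_iff[symmetric])
    also have "\<dots> \<longleftrightarrow> int s = int r" using that by (simp add: r(2))
    also have "\<dots> \<longleftrightarrow> s = r" by simp
    finally show ?thesis .
  qed
  then have "(\<Sum>s<d. if int d dvd int s - a then c else 0) = (\<Sum>s<d. if s = r then c else 0)"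
    by (intro sum.cong) auto
  then show ?thesis using r by simp
qed

section \<open>Matrices on the tensor product as forms on index pairs\<close>

lemma cscalar_prod_mult_mat_vec:
  assumes "A \<in> carrier_mat n n"
  shows "(A *\<^sub>v vec n f) \<bullet>c vec n f = (\<Sum>i<n. \<Sum>j<n. A $$ (i, j) * f j * cnj (f i))"
  using assms
  by (auto simp: scalar_prod_def mult_mat_vec_def sum_distrib_right atLeast0LessThan intro!: sum.cong)

lemma pair_index_less: "s * d + t < d * d" if "s < d" "t < (d::nat)"
proof -
  have "s * d + t < Suc s * d" using that by simp
  also have "\<dots> \<le> d * d" using that by (intro mult_right_mono) auto
  finally show ?thesis .
qed

lemma bij_betw_pair_index:
  "bij_betw (\<lambda>(s, t). s * d + t) ({..<d} \<times> {..<d}) {..<d * d :: nat}"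
  by (rule bij_betw_byWitness[where f' = "\<lambda>i. (i div d, i mod d)"])
    (auto simp: pair_index_less less_mult_imp_div_less intro!: mod_less_divisor gr0I)

lemma index_max_entangled:
  assumes "s < d" "t < d"
  shows "max_entangled d $ (s * d + t) = (if s = t then of_real (1 / sqrt (real d)) else 0)"
proof -
  have i: "s * d + t < d * d"
    using assms by (rule pair_index_less)
  have c: "(\<lambda>m. tensor_vec (unit_vec d m) (unit_vec d m)) \<in> {..<d} \<rightarrow> carrier_vec (d * d)"
    by (auto simp: tensor_vec_def)
  have [simp]: "(s * d + t) div d = s" "(s * d + t) mod d = t" using assms by auto
  have ten: "tensor_vec (unit_vec d m) (unit_vec d m) $ (s * d + t) =
      (if m = s then if s = t then 1 else 0 else 0)" if "m < d" for m
    using assms i that by (simp add: tensor_vec_def unit_vec_def)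
  have "finsum_vec TYPE(complex) (d * d) (\<lambda>m. tensor_vec (unit_vec d m) (unit_vec d m)) {..<d} $ (s * d + t)
     = (\<Sum>m<d. if m = s then if s = t then 1 else 0 else 0)"
    by (simp only: index_finsum_vec[OF finite_lessThan i c]) (intro sum.cong refl, simp add: ten)
  also have "\<dots> = (if s = t then 1 else 0)" using assms by simp
  finally show ?thesis
    using i c by (simp add: max_entangled_def finsum_vec_closed[OF c, unfolded carrier_vec_def, simplified])
qed


text \<open>Indexing by pairs confines \<open>div\<close> and \<open>mod\<close> to the translation
  lemmas.\<close>

definition pair_form :: "nat \<Rightarrow> complex mat \<Rightarrow> nat \<times> nat \<Rightarrow> nat \<times> nat \<Rightarrow> complex" where
  "pair_form d A = (\<lambda>(s, t) (s', t'). A $$ (s * d + t, s' * d + t'))"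

lemma expectation_value_pair:
  assumes "A \<in> carrier_mat (d * d) (d * d)"
  shows "expectation_value A (vec (d * d) f) =
    quad_form ({..<d} \<times> {..<d}) (pair_form d A) (\<lambda>(s, t). f (s * d + t))"
  unfolding expectation_value_def cscalar_prod_mult_mat_vec[OF assms] quad_form_def
    sum.reindex_bij_betw[OF bij_betw_pair_index, symmetric]
  by (simp add: pair_form_def case_prod_unfold)

lemma quad_form_pair_nonneg:
  assumes "pos_semidef (d * d) A"
  shows "0 \<le> quad_form ({..<d} \<times> {..<d}) (pair_form d A) f"
proof -
  define v where "v = vec (d * d) (\<lambda>i. f (i div d, i mod d))"
  have "0 \<le> (A *\<^sub>v v) \<bullet>c v"
    using assms by (simp add: pos_semidef_def v_def)
  then have "0 \<le> expectation_value A v"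
    by (simp add: expectation_value_def less_eq_complex_def)
  also have "expectation_value A v =
      quad_form ({..<d} \<times> {..<d}) (pair_form d A) (\<lambda>(s, t). f ((s * d + t) div d, (s * d + t) mod d))"
    unfolding v_def using assms by (simp add: expectation_value_pair pos_semidef_def)
  also have "\<dots> = quad_form ({..<d} \<times> {..<d}) (pair_form d A) f"
    by (intro quad_form_cong) auto
  finally show ?thesis .
qed

lemma trace_mat_pair:
  assumes "A \<in> carrier_mat (d * d) (d * d)"
  shows "trace_mat A = (\<Sum>x\<in>{..<d} \<times> {..<d}. pair_form d A x x)"
  using assms unfolding trace_mat_def
  by (simp add: sum.reindex_bij_betw[OF bij_betw_pair_index, symmetric] pair_form_def case_prod_unfold)

section \<open>Entries and completeness of the Wootters-Fields bases\<close>

definition wf_entry :: "nat \<Rightarrow> nat \<Rightarrow> nat \<Rightarrow> nat \<Rightarrow> complex" where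
  "wf_entry d k j m = of_real (1 / sqrt (real d)) * add_char d (int j * int m + int k * (int m)\<^sup>2)"

lemma index_wootters_fields:
  "m < d \<Longrightarrow> wootters_fields d k j $ m = wf_entry d k j m"
  by (simp add: wootters_fields_def wf_entry_def omega_power)

lemma wf_entry_mult_cnj:
  "wf_entry d k j s * cnj (wf_entry d k l t) =
    of_real (1 / real d) *
      add_char d (int j * int s + int k * (int s)\<^sup>2 - int l * int t - int k * (int t)\<^sup>2)"
proof -
  define c :: complex where "c = of_real (1 / sqrt (real d))"
  have c: "c * c = of_real (1 / real d)" "cnj c = c"
    unfolding c_def of_real_mult[symmetric] by simp_all
  have "wf_entry d k j s * cnj (wf_entry d k l t) = (c * c) *
      (add_char d (int j * int s + int k * (int s)\<^sup>2) * add_char d (- (int l * int t + int k * (int t)\<^sup>2)))"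
    unfolding wf_entry_def complex_cnj_mult c_def[symmetric] c(2) cnj_add_char by (simp only: mult_ac)
  also have "\<dots> = (c * c) *
      add_char d (int j * int s + int k * (int s)\<^sup>2 - int l * int t - int k * (int t)\<^sup>2)"
    unfolding add_char_add[symmetric] by (simp only: add_uminus_conv_diff diff_diff_eq)
  finally show ?thesis by (simp only: c(1))
qed

text \<open>The quadratic phase does not depend on the label \<open>j\<close>, so it leaves the sum.
  What remains is a character sum in \<open>j\<close> with frequency \<open>s - s'\<close>, and the
  phase is 1 when \<open>s = s'\<close>.\<close>

lemma wf_entry_resolution:
  assumes "s < d" "s' < d"
  shows "(\<Sum>j<d. wf_entry d k j s * cnj (wf_entry d k j s')) = (if s = s' then 1 else 0)"
proof -
  have d: "0 < d" using assms by simp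
  have "wf_entry d k j s * cnj (wf_entry d k j s') =
      of_real (1 / real d) * add_char d (int k * (int s)\<^sup>2 - int k * (int s')\<^sup>2) *
        add_char d (int j * (int s - int s'))" for j
  proof -
    have "int j * int s + int k * (int s)\<^sup>2 - int j * int s' - int k * (int s')\<^sup>2 =
        (int k * (int s)\<^sup>2 - int k * (int s')\<^sup>2) + int j * (int s - int s')"
      by (simp add: algebra_simps)
    then show ?thesis
      by (simp only: wf_entry_mult_cnj add_char_add mult.assoc)
  qed
  then have "(\<Sum>j<d. wf_entry d k j s * cnj (wf_entry d k j s')) =
      of_real (1 / real d) * add_char d (int k * (int s)\<^sup>2 - int k * (int s')\<^sup>2) *
        (\<Sum>j<d. add_char d (int j * (int s - int s')))"
    by (simp only: sum_distrib_left)
  then show ?thesis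
    using d by (simp add: sum_add_char int_dvd_diff_less_iff[OF assms])
qed

definition wf_pair :: "nat \<Rightarrow> nat \<Rightarrow> nat \<times> nat \<Rightarrow> nat \<times> nat \<Rightarrow> complex" where
  "wf_pair d k = (\<lambda>(j, l) (s, t). wf_entry d k j s * cnj (wf_entry d k l t))"

text \<open>The sum over label pairs factors into the completeness relations of the two tensor
  factors; the conjugation in the second one exchanges \<open>t\<close> and
  \<open>t'\<close>.\<close>

lemma wf_pair_resolution:
  assumes "x \<in> {..<d} \<times> {..<d}" "y \<in> {..<d} \<times> {..<d}"
  shows "(\<Sum>a\<in>{..<d} \<times> {..<d}. wf_pair d k a x * cnj (wf_pair d k a y)) = (if x = y then 1 else 0)"
proof -
  obtain s t s' t' where xy: "x = (s, t)" "y = (s', t')" by fastforce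
  have "(\<Sum>a\<in>{..<d} \<times> {..<d}. wf_pair d k a x * cnj (wf_pair d k a y)) =
      (\<Sum>j<d. \<Sum>l<d. (wf_entry d k j s * cnj (wf_entry d k j s')) *
         (wf_entry d k l t' * cnj (wf_entry d k l t)))"
    unfolding sum.cartesian_product xy
    by (intro sum.cong refl) (auto simp: wf_pair_def mult_ac)
  also have "\<dots> = (if s = s' then 1 else 0) * (if t' = t then 1 else 0)"
    using assms unfolding sum_product[symmetric] xy by (simp add: wf_entry_resolution)
  finally show ?thesis using xy by auto
qed

lemma wf_prob_pair:
  assumes "A \<in> carrier_mat (d * d) (d * d)"
  shows "wf_prob d A k j l = quad_form ({..<d} \<times> {..<d}) (pair_form d A) (wf_pair d k (j, l))"
proof -
  have dim: "dim_vec (wootters_fields d k j) = d" for j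
    by (simp add: wootters_fields_def)
  have "tensor_vec (wootters_fields d k j) (conjugate (wootters_fields d k l)) =
      vec (d * d) (\<lambda>i. wf_pair d k (j, l) (i div d, i mod d))"
  proof (rule eq_vecI)
    fix i assume "i < dim_vec (vec (d * d) (\<lambda>i. wf_pair d k (j, l) (i div d, i mod d)))"
    then have i: "i < d * d" by simp
    then have "0 < d" by (cases d) auto
    then have "i div d < d" "i mod d < d" using i by (auto simp: less_mult_imp_div_less)
    then show "tensor_vec (wootters_fields d k j) (conjugate (wootters_fields d k l)) $ i =
        vec (d * d) (\<lambda>i. wf_pair d k (j, l) (i div d, i mod d)) $ i"
      using i by (simp add: tensor_vec_def dim index_wootters_fields wf_pair_def)
  qed (simp add: tensor_vec_def dim)
  then have "wf_prob d A k j l = quad_form ({..<d} \<times> {..<d}) (pair_form d A)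
      (\<lambda>(s, t). wf_pair d k (j, l) ((s * d + t) div d, (s * d + t) mod d))"
    by (simp add: wf_prob_def expectation_value_pair[OF assms])
  also have "\<dots> = quad_form ({..<d} \<times> {..<d}) (pair_form d A) (wf_pair d k (j, l))"
    by (intro quad_form_cong) auto
  finally show ?thesis .
qed

section \<open>The shifted vectors and their expectations\<close>

definition shift_vec :: "nat \<Rightarrow> nat \<Rightarrow> nat \<Rightarrow> nat \<times> nat \<Rightarrow> complex" where
  "shift_vec d k \<delta> = (\<lambda>(s, t). of_real (1 / sqrt (real d)) *
     (if int d dvd int s - (int t + int \<delta>) then add_char d (int k * ((int s)\<^sup>2 - (int t)\<^sup>2)) else 0))"

lemma expectation_value_max_entangled:
  assumes "A \<in> carrier_mat (d * d) (d * d)"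
  shows "expectation_value A (max_entangled d) =
    quad_form ({..<d} \<times> {..<d}) (pair_form d A) (shift_vec d k 0)"
proof -
  have "(\<lambda>m. tensor_vec (unit_vec d m) (unit_vec d m)) \<in> {..<d} \<rightarrow> carrier_vec (d * d)"
    by (auto simp: tensor_vec_def)
  from finsum_vec_closed[OF this] have dim: "dim_vec (max_entangled d) = d * d"
    unfolding max_entangled_def by simp
  have "max_entangled d = vec (d * d) (($) (max_entangled d))"
    by (rule eq_vecI) (simp_all add: dim)
  then have "expectation_value A (max_entangled d) =
      expectation_value A (vec (d * d) (($) (max_entangled d)))"
    by (rule arg_cong)
  also have "\<dots> = quad_form ({..<d} \<times> {..<d}) (pair_form d A)
      (\<lambda>(s, t). max_entangled d $ (s * d + t))"
    by (rule expectation_value_pair[OF assms])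
  \<comment> \<open>With shift 0 the support is \<open>s = t\<close>, where the phase is 1 for every
    \<open>k\<close>.\<close>
  also have "\<dots> = quad_form ({..<d} \<times> {..<d}) (pair_form d A) (shift_vec d k 0)"
    by (intro quad_form_cong)
      (clarsimp simp: shift_vec_def index_max_entangled int_dvd_diff_less_iff)
  finally show ?thesis .
qed

text \<open>Both kernels are \<open>1 / d\<close> times the phase \<open>E\<close> when
  \<open>s - t\<close> and \<open>s' - t'\<close> agree modulo \<open>d\<close>, and vanish
  otherwise: on the left the sum over \<open>m\<close> is a character sum, on the right only the
  \<open>\<delta>\<close> congruent to \<open>s - t\<close> contributes.\<close>

lemma sum_wf_pair_diagonal:
  assumes "x \<in> {..<d} \<times> {..<d}" "y \<in> {..<d} \<times> {..<d}"
  shows "(\<Sum>m<d. wf_pair d k (m, m) y * cnj (wf_pair d k (m, m) x)) =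
         (\<Sum>\<delta><d. shift_vec d k \<delta> y * cnj (shift_vec d k \<delta> x))"
proof -
  obtain s t s' t' where xy: "y = (s, t)" "x = (s', t')" by fastforce
  then have d: "0 < d" using assms by auto
  define E where "E = add_char d (int k * ((int s)\<^sup>2 - (int t)\<^sup>2) - int k * ((int s')\<^sup>2 - (int t')\<^sup>2))"
  let ?D = "(int s - int t) - (int s' - int t')"
  have c2: "(of_real (1 / sqrt (real d)) :: complex) * of_real (1 / sqrt (real d)) = of_real (1 / real d)"
    unfolding of_real_mult[symmetric] by simp
  have "wf_pair d k (m, m) y * cnj (wf_pair d k (m, m) x) =
      of_real (1 / real d) * of_real (1 / real d) * E * add_char d (int m * ?D)" for m
  proof -
    have "wf_pair d k (m, m) y * cnj (wf_pair d k (m, m) x) = of_real (1 / real d) * of_real (1 / real d) *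
      (add_char d (int m * int s + int k * (int s)\<^sup>2 - int m * int t - int k * (int t)\<^sup>2) *
       add_char d (- (int m * int s' + int k * (int s')\<^sup>2 - int m * int t' - int k * (int t')\<^sup>2)))"
      unfolding wf_pair_def xy
      by (simp only: prod.case wf_entry_mult_cnj complex_cnj_mult complex_cnj_complex_of_real cnj_add_char mult_ac)
    moreover have "(int m * int s + int k * (int s)\<^sup>2 - int m * int t - int k * (int t)\<^sup>2) +
        - (int m * int s' + int k * (int s')\<^sup>2 - int m * int t' - int k * (int t')\<^sup>2) =
        (int k * ((int s)\<^sup>2 - (int t)\<^sup>2) - int k * ((int s')\<^sup>2 - (int t')\<^sup>2)) + int m * ?D"
      by (simp add: algebra_simps)
    ultimately show ?thesis
      unfolding E_def by (simp only: mult.assoc add_char_add[symmetric])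
  qed
  then have "(\<Sum>m<d. wf_pair d k (m, m) y * cnj (wf_pair d k (m, m) x)) =
      of_real (1 / real d) * of_real (1 / real d) * E * (\<Sum>m<d. add_char d (int m * ?D))"
    by (simp only: sum_distrib_left)
  also have "\<dots> = of_real (1 / real d) * (if int d dvd ?D then E else 0)"
    using d by (simp add: sum_add_char)
  finally have L: "(\<Sum>m<d. wf_pair d k (m, m) y * cnj (wf_pair d k (m, m) x)) =
      of_real (1 / real d) * (if int d dvd ?D then E else 0)" .
  \<comment> \<open>The support condition is solved for \<open>\<delta>\<close> so that
    \<open>sum_unique_residue\<close> can sum over the shift; given it, the condition on the second
    pair is the one on \<open>?D\<close>.\<close>
  have "shift_vec d k \<delta> y * cnj (shift_vec d k \<delta> x) =
      of_real (1 / real d) * (if int d dvd int \<delta> - (int s - int t) then if int d dvd ?D then E else 0 else 0)" for \<delta>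
  proof -
    have 1: "int d dvd int s - (int t + int \<delta>) \<longleftrightarrow> int d dvd int \<delta> - (int s - int t)"
    proof -
      have "int s - (int t + int \<delta>) = - (int \<delta> - (int s - int t))" by simp
      then show ?thesis by (metis dvd_minus_iff)
    qed
    have 2: "int d dvd int s' - (int t' + int \<delta>) \<longleftrightarrow> int d dvd ?D"
      if "int d dvd int s - (int t + int \<delta>)"
    proof -
      have "int s' - (int t' + int \<delta>) = (int s - (int t + int \<delta>)) - ?D" by simp
      then show ?thesis using dvd_diff_right_iff[OF that, of ?D] by (simp only:)
    qed
    have E: "E = add_char d (int k * ((int s)\<^sup>2 - (int t)\<^sup>2)) * cnj (add_char d (int k * ((int s')\<^sup>2 - (int t')\<^sup>2)))"
      unfolding E_def cnj_add_char add_char_add[symmetric] by simp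
    show ?thesis
    proof (cases "int d dvd int s - (int t + int \<delta>) \<and> int d dvd ?D")
      case True
      then have "shift_vec d k \<delta> y * cnj (shift_vec d k \<delta> x) =
          of_real (1 / sqrt (real d)) * of_real (1 / sqrt (real d)) * E"
        using 2 unfolding shift_vec_def xy E
        by (simp only: prod.case if_True complex_cnj_mult complex_cnj_complex_of_real mult_ac)
      then show ?thesis using True 1 unfolding c2 by simp
    next
      case False
      then show ?thesis using 1 2 unfolding shift_vec_def xy by auto
    qed
  qed
  then have "(\<Sum>\<delta><d. shift_vec d k \<delta> y * cnj (shift_vec d k \<delta> x)) =
      of_real (1 / real d) * (\<Sum>\<delta><d. if int d dvd int \<delta> - (int s - int t) then if int d dvd ?D then E else 0 else 0)"
    by (simp only: sum_distrib_left)
  then show ?thesis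
    unfolding L by (simp only: sum_unique_residue[OF d])
qed

lemma cmod_shift_vec_wf_pair:
  assumes d: "0 < d"
  shows "cmod (\<Sum>y\<in>{..<d} \<times> {..<d}. shift_vec d k' \<delta> y * cnj (wf_pair d k (j, l) y)) =
    (if int d dvd int l - int j + 2 * (int k' - int k) * int \<delta> then 1 / sqrt (real d) else 0)"
proof -
  let ?\<kappa> = "int k' - int k"
  let ?a = "int l - int j + 2 * ?\<kappa> * int \<delta>"
  \<comment> \<open>Substituting \<open>s = t + \<delta>\<close> splits the exponent into
    \<open>t * ?a\<close> and a part free of \<open>t\<close>, which goes into
    \<open>C\<close>.\<close>
  define C where "C = of_real (1 / sqrt (real d)) * of_real (1 / real d) *
    add_char d (?\<kappa> * (int \<delta>)\<^sup>2 - int j * int \<delta>)"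
  have "shift_vec d k' \<delta> (s, t) * cnj (wf_pair d k (j, l) (s, t)) =
      (if int d dvd int s - (int t + int \<delta>) then C * add_char d (int t * ?a) else 0)" for s t
  proof (cases "int d dvd int s - (int t + int \<delta>)")
    case True
    let ?e = "int k' * ((int s)\<^sup>2 - (int t)\<^sup>2)
      - (int j * int s + int k * (int s)\<^sup>2 - int l * int t - int k * (int t)\<^sup>2)"
    \<comment> \<open>The factorization shows that the two exponents differ by a multiple of
      \<open>s - (t + \<delta>)\<close>, hence of \<open>d\<close>.\<close>
    have "?e - (?\<kappa> * (int \<delta>)\<^sup>2 - int j * int \<delta> + int t * ?a) =
        (int s - (int t + int \<delta>)) * (?\<kappa> * (int s + int t + int \<delta>) - int j)"
      by (simp add: algebra_simps power2_eq_square)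
    then have "add_char d ?e = add_char d (?\<kappa> * (int \<delta>)\<^sup>2 - int j * int \<delta> + int t * ?a)"
      using True by (intro add_char_cong[OF d]) simp
    moreover have "shift_vec d k' \<delta> (s, t) * cnj (wf_pair d k (j, l) (s, t)) =
        of_real (1 / sqrt (real d)) * of_real (1 / real d) * add_char d ?e"
    proof -
      have "add_char d ?e = add_char d (int k' * ((int s)\<^sup>2 - (int t)\<^sup>2)) *
          cnj (add_char d (int j * int s + int k * (int s)\<^sup>2 - int l * int t - int k * (int t)\<^sup>2))"
        unfolding cnj_add_char add_char_add[symmetric] by (simp only: add_uminus_conv_diff)
      moreover have "shift_vec d k' \<delta> (s, t) =
          of_real (1 / sqrt (real d)) * add_char d (int k' * ((int s)\<^sup>2 - (int t)\<^sup>2))"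
        using True by (simp add: shift_vec_def)
      moreover have "wf_pair d k (j, l) (s, t) = of_real (1 / real d) *
          add_char d (int j * int s + int k * (int s)\<^sup>2 - int l * int t - int k * (int t)\<^sup>2)"
        by (simp only: wf_pair_def prod.case wf_entry_mult_cnj)
      ultimately show ?thesis
        by (simp only: complex_cnj_mult complex_cnj_complex_of_real mult_ac)
    qed
    ultimately have "shift_vec d k' \<delta> (s, t) * cnj (wf_pair d k (j, l) (s, t)) =
        C * add_char d (int t * ?a)"
      by (simp only: C_def add_char_add[of d "?\<kappa> * (int \<delta>)\<^sup>2 - int j * int \<delta>"] mult.assoc[where 'a = complex])
    then show ?thesis
      using True by simp
  qed (simp add: shift_vec_def)
  then have "(\<Sum>y\<in>{..<d} \<times> {..<d}. shift_vec d k' \<delta> y * cnj (wf_pair d k (j, l) y)) =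
      (\<Sum>s<d. \<Sum>t<d. if int d dvd int s - (int t + int \<delta>) then C * add_char d (int t * ?a) else 0)"
    unfolding sum.cartesian_product by (intro sum.cong refl) (simp only: split_paired_all prod.case)
  also have "\<dots> = (\<Sum>t<d. C * add_char d (int t * ?a))"
    by (subst sum.swap) (simp only: sum_unique_residue[OF d])
  also have "\<dots> = C * (if int d dvd ?a then of_nat d else 0)"
    by (simp only: sum_distrib_left[symmetric] sum_add_char[OF d])
  finally have *: "(\<Sum>y\<in>{..<d} \<times> {..<d}. shift_vec d k' \<delta> y * cnj (wf_pair d k (j, l) y)) =
      C * (if int d dvd ?a then of_nat d else 0)" .
  \<comment> \<open>\<open>C\<close> carries \<open>d\<close> to the power -3/2, and the character
    sum contributes \<open>d\<close>.\<close>
  have "cmod C * real d = 1 / sqrt (real d)"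
    using d unfolding C_def norm_mult by (simp add: norm_divide)
  then show ?thesis
    unfolding * norm_mult by simp
qed

text \<open>All nonzero coefficients in the basis \<open>k\<close> have modulus
  \<open>1 / sqrt d\<close>, which squares to the factor \<open>1 / d\<close>. The square stays a
  double sum so that the sum over \<open>\<delta>\<close> can later be moved inside.\<close>

lemma quad_form_shift_vec_le:
  fixes k k' \<delta> :: nat
  assumes psd: "pos_semidef (d * d) A" and d: "0 < d"
  defines "D \<equiv> \<lambda>a. int d dvd int (snd a) - int (fst a) + 2 * (int k' - int k) * int \<delta>"
  defines "g \<equiv> \<lambda>a. sqrt (quad_form ({..<d} \<times> {..<d}) (pair_form d A) (wf_pair d k a))"
  shows "quad_form ({..<d} \<times> {..<d}) (pair_form d A) (shift_vec d k' \<delta>) \<le>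
    1 / real d * (\<Sum>a\<in>{..<d} \<times> {..<d}. \<Sum>b\<in>{..<d} \<times> {..<d}. if D a \<and> D b then g a * g b else 0)"
proof -
  define X where "X = {..<d} \<times> {..<d}"
  let ?q = "quad_form X (pair_form d A)"
  define c where "c a = (\<Sum>y\<in>X. shift_vec d k' \<delta> y * cnj (wf_pair d k a y))" for a
  have q0: "0 \<le> ?q f" for f
    using quad_form_pair_nonneg[OF psd] by (simp add: X_def)
  have cm: "cmod (c a) = (if D a then 1 / sqrt (real d) else 0)" for a
    unfolding c_def X_def D_def using cmod_shift_vec_wf_pair[OF d, of k' \<delta> k "fst a" "snd a"] by simp
  have "?q (shift_vec d k' \<delta>) = ?q (\<lambda>x. \<Sum>a\<in>X. c a * wf_pair d k a x)"
    unfolding c_def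
    by (rule quad_form_cong, rule resolution_expand[symmetric])
      (use wf_pair_resolution in \<open>auto simp: X_def\<close>)
  then have "sqrt (?q (shift_vec d k' \<delta>)) \<le> (\<Sum>a\<in>X. cmod (c a) * g a)"
    unfolding g_def X_def[symmetric]
    using sqrt_quad_form_sum[OF q0, of X c "wf_pair d k"] by (simp add: X_def)
  then have "(sqrt (?q (shift_vec d k' \<delta>)))\<^sup>2 \<le> (\<Sum>a\<in>X. cmod (c a) * g a)\<^sup>2"
    using q0 by (intro power_mono) auto
  then have "?q (shift_vec d k' \<delta>) \<le> (\<Sum>a\<in>X. cmod (c a) * g a)\<^sup>2"
    using q0 by simp
  also have "\<dots> = (\<Sum>a\<in>X. \<Sum>b\<in>X. 1 / real d * (if D a \<and> D b then g a * g b else 0))"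
    unfolding power2_eq_square sum_product cm by (intro sum.cong refl) auto
  finally show ?thesis
    unfolding X_def sum_distrib_left .
qed

section \<open>From the bounds for single shifts to the sum over index quadruples\<close>

lemma sum_at_most_one_le:
  fixes v :: real
  assumes "finite K" "0 \<le> v" "\<And>x y. x \<in> K \<Longrightarrow> y \<in> K \<Longrightarrow> P x \<Longrightarrow> P y \<Longrightarrow> x = y"
    and "\<And>x. x \<in> K \<Longrightarrow> P x \<Longrightarrow> R"
  shows "(\<Sum>x\<in>K. if P x then v else 0) \<le> (if R then v else 0)"
proof (cases "\<exists>x\<in>K. P x")
  case True
  then obtain z where z: "z \<in> K" "P z" by blast
  then have "(\<Sum>x\<in>K. if P x then v else 0) = (\<Sum>x\<in>K. if x = z then v else 0)"
    using assms(3) by (intro sum.cong) auto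
  then show ?thesis using z assms by simp
next
  case False
  then have "(\<Sum>x\<in>K. if P x then v else 0) = 0" by (intro sum.neutral) auto
  then show ?thesis using assms(2) by simp
qed

text \<open>Grouping the indices as \<open>a = (m, n)\<close> and \<open>b = (m', n')\<close> allows
  a termwise comparison with double sums over pairs.\<close>

lemma sum_offdiagonal_quadruples:
  fixes h :: "nat \<Rightarrow> nat \<Rightarrow> nat \<Rightarrow> nat \<Rightarrow> real"
  shows "(\<Sum>(m, n, m', n') \<in> {(m, n, m', n'). m < d \<and> n < d \<and> m' < d \<and> n' < d \<and>
          m \<noteq> m' \<and> m \<noteq> n \<and> n \<noteq> n' \<and> n' \<noteq> m'}. h m n m' n') =
    (\<Sum>a\<in>{..<d} \<times> {..<d}. \<Sum>b\<in>{..<d} \<times> {..<d}.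
      if fst a \<noteq> fst b \<and> fst a \<noteq> snd a \<and> snd a \<noteq> snd b \<and> snd b \<noteq> fst b
      then h (fst a) (snd a) (fst b) (snd b) else 0)" (is "?L = ?R")
proof -
  let ?X = "{..<d} \<times> {..<d}"
  let ?c = "\<lambda>p. fst (fst p) \<noteq> fst (snd p) \<and> fst (fst p) \<noteq> snd (fst p) \<and>
      snd (fst p) \<noteq> snd (snd p) \<and> snd (snd p) \<noteq> fst (snd p)"
  let ?h = "\<lambda>p. h (fst (fst p)) (snd (fst p)) (fst (snd p)) (snd (snd p))"
  have "?R = (\<Sum>p\<in>?X \<times> ?X. if ?c p then ?h p else 0)"
    by (simp only: sum.cartesian_product case_prod_unfold)
  also have "\<dots> = (\<Sum>p\<in>{p \<in> ?X \<times> ?X. ?c p}. ?h p)"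
    by (rule sum.inter_filter[symmetric]) simp
  also have "\<dots> = ?L"
    by (rule sum.reindex_bij_witness[where i = "\<lambda>(m, n, m', n'). ((m, n), (m', n'))"
          and j = "\<lambda>((m, n), (m', n')). (m, n, m', n')"]) auto
  finally show ?thesis by simp
qed

theorem mainTheorem1:
  fixes d k k' :: nat and \<rho> :: "complex mat"
  assumes "prime d" and "odd d"
    and "density_operator (d * d) \<rho>"
    and "k < d" and "k' < d" and "k \<noteq> k'"
  shows "expectation_value \<rho> (max_entangled d) \<ge>
    1 / real d * (\<Sum>m<d. wf_prob d \<rho> k m m) + (\<Sum>m<d. wf_prob d \<rho> k' m m) - 1 / real d
    - (\<Sum>(m, n, m', n') \<in> {(m, n, m', n'). m < d \<and> n < d \<and> m' < d \<and> n' < d \<and>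
          m \<noteq> m' \<and> m \<noteq> n \<and> n \<noteq> n' \<and> n' \<noteq> m'}.
        gamma_tilde d m n m' n' * sqrt (wf_prob d \<rho> k m' n' * wf_prob d \<rho> k m n))"
proof -
  define X where "X = {..<d} \<times> {..<d}"
  define q where "q = quad_form X (pair_form d \<rho>)"
  define P where "P a = q (wf_pair d k a)" for a
  define D where "D \<delta> a \<longleftrightarrow> int d dvd int (snd a) - int (fst a) + 2 * (int k' - int k) * int \<delta>"
    for \<delta> :: nat and a :: "nat \<times> nat"
  have d: "0 < d" using assms(1) by (simp add: prime_gt_0_nat)
  have finX: "finite X" by (simp add: X_def)
  have psd: "pos_semidef (d * d) \<rho>" and tr: "trace_mat \<rho> = 1"
    using assms(3) by (auto simp: density_operator_def)
  then have car: "\<rho> \<in> carrier_mat (d * d) (d * d)" by (simp add: pos_semidef_def)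
  have q0: "0 \<le> q f" for f
    using quad_form_pair_nonneg[OF psd] by (simp add: X_def q_def)
  have P0: "0 \<le> P a" for a by (simp add: P_def q0)
  have prob: "wf_prob d \<rho> l m n = q (wf_pair d l (m, n))" for l m n
    unfolding q_def X_def by (rule wf_prob_pair[OF car])

  \<comment> \<open>Completeness of the product basis turns the kernel into the identity, so the sum
    is the trace of \<open>\<rho>\<close>.\<close>
  have total: "(\<Sum>a\<in>X. P a) = 1"
  proof -
    have "(\<Sum>a\<in>X. P a) = Re (\<Sum>x\<in>X. \<Sum>y\<in>X. pair_form d \<rho> x y *
        (\<Sum>a\<in>X. wf_pair d k a y * cnj (wf_pair d k a x)))"
      unfolding P_def q_def by (rule sum_quad_form)
    also have "\<dots> = Re (\<Sum>x\<in>X. \<Sum>y\<in>X. if y = x then pair_form d \<rho> x y else 0)"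
      by (intro arg_cong[where f = Re] sum.cong refl)
        (use wf_pair_resolution[where d = d and k = k] in \<open>auto simp: X_def\<close>)
    also have "\<dots> = Re (trace_mat \<rho>)"
      using finX by (simp add: trace_mat_pair[OF car] X_def)
    finally show ?thesis by (simp add: tr)
  qed

  have fid: "expectation_value \<rho> (max_entangled d) = q (shift_vec d k' 0)"
    unfolding q_def X_def by (rule expectation_value_max_entangled[OF car])
  have "(\<Sum>m<d. q (wf_pair d k' (m, m))) = (\<Sum>\<delta><d. q (shift_vec d k' \<delta>))"
    unfolding q_def sum_quad_form X_def
    by (intro arg_cong[where f = Re] sum.cong refl arg_cong2[where f = "(*)"] sum_wf_pair_diagonal)
  \<comment> \<open>Shift 0 carries the fidelity; the other shifts have to be bounded from
    above.\<close>
  also have "{..<d} = insert 0 {1..<d}" using d by auto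
  then have "(\<Sum>\<delta><d. q (shift_vec d k' \<delta>)) =
      q (shift_vec d k' 0) + (\<Sum>\<delta>\<in>{1..<d}. q (shift_vec d k' \<delta>))" by simp
  finally have decomp: "(\<Sum>m<d. wf_prob d \<rho> k' m m) =
      q (shift_vec d k' 0) + (\<Sum>\<delta>\<in>{1..<d}. q (shift_vec d k' \<delta>))"
    by (simp add: prob)

  \<comment> \<open>Oddness of \<open>d\<close> removes the factor 2, and \<open>k\<close>,
    \<open>k'\<close> are distinct residues. Primality then permits the cancellation in
    \<open>cancel\<close>.\<close>
  have unit: "\<not> int d dvd 2 * (int k' - int k)"
  proof
    assume "int d dvd 2 * (int k' - int k)"
    moreover have "coprime (int d) 2"
      using assms(2) by simp
    ultimately have "int d dvd int k' - int k"
      using coprime_dvd_mult_right_iff by blast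
    then show False
      using int_dvd_diff_less_iff assms(4-6) by blast
  qed
  have cancel: "\<delta> = \<delta>'"
    if "int d dvd 2 * (int k' - int k) * (int \<delta> - int \<delta>')" "\<delta> < d" "\<delta>' < d" for \<delta> \<delta>'
    using that unit assms(1) int_dvd_diff_less_iff[of \<delta> d \<delta>']
      prime_dvd_mult_iff[of "int d" "2 * (int k' - int k)" "int \<delta> - int \<delta>'"]
    by (simp add: prime_int_nat_transfer)
  \<comment> \<open>Subtracting the two conditions on \<open>a\<close> leaves a multiple of
    \<open>\<delta> - \<delta>'\<close>.\<close>
  have D_unique: "\<delta> = \<delta>'" if "D \<delta> a" "D \<delta>' a" "\<delta> < d" "\<delta>' < d" for \<delta> \<delta>' a
    using dvd_diff[OF that(1,2)[unfolded D_def]] that(3,4)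
    by (intro cancel) (simp_all add: algebra_simps)
  \<comment> \<open>On a diagonal pair the condition reduces to \<open>2 (k' - k) \<delta>\<close>
    being divisible by \<open>d\<close>.\<close>
  have D_off: "fst a \<noteq> snd a" if "D \<delta> a" "\<delta> < d" "\<delta> \<noteq> 0" for \<delta> a
  proof
    assume "fst a = snd a"
    then show False using cancel[of \<delta> 0] that d by (simp add: D_def)
  qed
  \<comment> \<open>Subtracting the conditions on \<open>a\<close> and \<open>b\<close> eliminates
    \<open>\<delta>\<close> and leaves the congruence of \<open>gamma_tilde\<close>.\<close>
  have D_cong: "int d dvd int (fst a) - int (fst b) - int (snd a) + int (snd b)"
    if "D \<delta> a" "D \<delta> b" for \<delta> a b
    using dvd_diff[OF that(2,1)[unfolded D_def]] by (simp add: algebra_simps)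

  \<comment> \<open>\<open>R\<close> keeps what a common shift between 1 and \<open>d - 1\<close>
    implies for \<open>a\<close> and \<open>b\<close>, without naming the shift.\<close>
  define R where "R a b \<longleftrightarrow> fst a \<noteq> snd a \<and> fst b \<noteq> snd b \<and>
      int d dvd int (fst a) - int (fst b) - int (snd a) + int (snd b)" for a b :: "nat \<times> nat"
  define S where "S a b = (if fst a \<noteq> fst b \<and> fst a \<noteq> snd a \<and> snd a \<noteq> snd b \<and> snd b \<noteq> fst b
      then gamma_tilde d (fst a) (snd a) (fst b) (snd b) * sqrt (P b * P a) else 0)"
    for a b :: "nat \<times> nat"
  \<comment> \<open>The terms with \<open>b = a\<close> give the probabilities themselves. For
    \<open>b \<noteq> a\<close> the congruence makes agreement in one coordinate force agreement in
    the other, so both coordinates differ, as the index set of the theorem demands.\<close>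
  have split: "1 / real d * (if R a b then sqrt (P a) * sqrt (P b) else 0) =
      (if b = a then 1 / real d * (if fst a \<noteq> snd a then P a else 0) else 0) + S a b"
    if "a \<in> X" "b \<in> X" for a b
  proof (cases "b = a")
    case True
    then show ?thesis using P0[of a] by (simp add: R_def S_def)
  next
    case False
    have "fst a \<noteq> fst b \<and> snd a \<noteq> snd b"
      if "int d dvd int (fst a) - int (fst b) - int (snd a) + int (snd b)"
    proof -
      have "fst a = fst b \<longleftrightarrow> snd a = snd b"
        using that \<open>a \<in> X\<close> \<open>b \<in> X\<close> int_dvd_diff_less_iff[of "fst a" d "fst b"]
          int_dvd_diff_less_iff[of "snd b" d "snd a"]
        by (auto simp: X_def)
      then show ?thesis using False by (auto simp: prod_eq_iff)
    qed
    then show ?thesis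
      using False by (auto simp: R_def S_def gamma_tilde_def cong_0_iff real_sqrt_mult)
  qed

  have "(\<Sum>\<delta>\<in>{1..<d}. q (shift_vec d k' \<delta>)) \<le>
      (\<Sum>\<delta>\<in>{1..<d}. 1 / real d *
        (\<Sum>a\<in>X. \<Sum>b\<in>X. if D \<delta> a \<and> D \<delta> b then sqrt (P a) * sqrt (P b) else 0))"
    unfolding q_def P_def X_def D_def by (intro sum_mono quad_form_shift_vec_le[OF psd d])
  also have "\<dots> = (\<Sum>a\<in>X. \<Sum>b\<in>X. 1 / real d *
        (\<Sum>\<delta>\<in>{1..<d}. if D \<delta> a \<and> D \<delta> b then sqrt (P a) * sqrt (P b) else 0))"
    unfolding sum_distrib_left by (subst sum.swap, subst (2) sum.swap) (rule refl)
  \<comment> \<open>By \<open>D_unique\<close> at most one shift contributes for given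
    \<open>a\<close> and \<open>b\<close>, so no multiplicity appears.\<close>
  also have "\<dots> \<le> (\<Sum>a\<in>X. \<Sum>b\<in>X. 1 / real d * (if R a b then sqrt (P a) * sqrt (P b) else 0))"
    using D_unique D_off D_cong P0
    by (intro sum_mono mult_left_mono sum_at_most_one_le) (auto simp: R_def)
  also have "\<dots> = (\<Sum>a\<in>X. \<Sum>b\<in>X.
      (if b = a then 1 / real d * (if fst a \<noteq> snd a then P a else 0) else 0) + S a b)"
    by (intro sum.cong refl split)
  also have "\<dots> = 1 / real d * (\<Sum>a\<in>X. if fst a \<noteq> snd a then P a else 0) + (\<Sum>a\<in>X. \<Sum>b\<in>X. S a b)"
    using finX by (simp add: sum.distrib sum_distrib_left)
  also have "(\<Sum>a\<in>X. if fst a \<noteq> snd a then P a else 0) = 1 - (\<Sum>m<d. wf_prob d \<rho> k m m)"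
  proof -
    have "(\<Sum>a\<in>X. if fst a \<noteq> snd a then P a else 0) =
        (\<Sum>a\<in>X. P a) - (\<Sum>a\<in>X. if fst a = snd a then P a else 0)"
      unfolding sum_subtractf[symmetric] by (intro sum.cong) auto
    also have "(\<Sum>a\<in>X. if fst a = snd a then P a else 0) = (\<Sum>m<d. \<Sum>n<d. if m = n then P (m, n) else 0)"
      unfolding X_def sum.cartesian_product by (intro sum.cong) auto
    also have "\<dots> = (\<Sum>m<d. wf_prob d \<rho> k m m)"
      by (simp add: prob P_def)
    finally show ?thesis by (simp add: total)
  qed
  also have "(\<Sum>a\<in>X. \<Sum>b\<in>X. S a b) =
    (\<Sum>(m, n, m', n') \<in> {(m, n, m', n'). m < d \<and> n < d \<and> m' < d \<and> n' < d \<and>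
          m \<noteq> m' \<and> m \<noteq> n \<and> n \<noteq> n' \<and> n' \<noteq> m'}.
        gamma_tilde d m n m' n' * sqrt (wf_prob d \<rho> k m' n' * wf_prob d \<rho> k m n))"
    unfolding sum_offdiagonal_quadruples S_def X_def prob P_def prod.collapse by (rule refl)
  finally show ?thesis
    unfolding fid decomp by (simp add: algebra_simps)
qed

end
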